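(* Every finite simple bipartite graph with no vertex of degree $0$ or $2$ admits an antimagic orientation.
   Context: All graphs are finite and simple; graphs are not assumed to be connected. An orientation $D$ of a graph $G$ is a directed graph obtained by assigning one direction to each edge of $G$; $A(D)$ denotes its set of arcs. Let $D$ be a directed graph with $m$ arcs and let $\sigma: A(D)\to\mathbb{Z}$ be an injective labeling. The oriented vertex sum at a vertex $v$ is the sum of the labels of all arcs entering $v$ minus the sum of the labels of all arcs leaving $v$. An antimagic labeling of $D$ is a bijection $\sigma: A(D)\to\{1,\ldots,m\}$ such that the oriented vertex sums of all vertices of $D$ are pairwise distinct. A graph $G$ admits an antimagic orientation if some orientation of $G$ has an antimagic labeling. *)

theory Defs
  imports "Graph_Theory.Graph_Theory"
begin

text \<open>
  A finite simple undirected graph is a \<open>pair_graph\<close>: a finite, loopless, symmetric relation on the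
  vertices, in which an edge \<open>uv\<close> is the pair of opposite arcs \<open>(u,v)\<close> and \<open>(v,u)\<close>. Hence the degree
  of \<open>v\<close> is \<open>out_degree G v\<close>, since every edge at \<open>v\<close> contributes exactly one arc leaving \<open>v\<close>.
\<close>

definition bipartite :: "('a, 'b) pre_digraph \<Rightarrow> bool" where
  "bipartite G \<longleftrightarrow> (\<exists>X Y. verts G = X \<union> Y \<and> X \<inter> Y = {} \<and> arcs_ends G \<subseteq> X \<times> Y \<union> Y \<times> X)"

text \<open>From each pair of opposite arcs of \<open>G\<close>, exactly one is kept.\<close>

definition orientation_of :: "'a pair_pre_digraph \<Rightarrow> 'a pair_pre_digraph \<Rightarrow> bool" where
  "orientation_of G D \<longleftrightarrow> pverts D = pverts G \<and> parcs D \<subseteq> parcs G \<and>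
     (\<forall>(u, v) \<in> parcs G. (u, v) \<in> parcs D \<longleftrightarrow> (v, u) \<notin> parcs D)"

definition oriented_vertex_sum :: "('a, 'b) pre_digraph \<Rightarrow> ('b \<Rightarrow> int) \<Rightarrow> 'a \<Rightarrow> int" where
  "oriented_vertex_sum D \<sigma> v = (\<Sum>a\<in>in_arcs D v. \<sigma> a) - (\<Sum>a\<in>out_arcs D v. \<sigma> a)"

definition antimagic_labeling :: "('a, 'b) pre_digraph \<Rightarrow> ('b \<Rightarrow> int) \<Rightarrow> bool" where
  "antimagic_labeling D \<sigma> \<longleftrightarrow>
     bij_betw \<sigma> (arcs D) {1..int (card (arcs D))} \<and> inj_on (oriented_vertex_sum D \<sigma>) (verts D)"

definition admits_antimagic_orientation :: "'a pair_pre_digraph \<Rightarrow> bool" where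
  "admits_antimagic_orientation G \<longleftrightarrow>
     (\<exists>D \<sigma>. orientation_of G D \<and> antimagic_labeling (with_proj D) \<sigma>)"

end

theory Submission
  imports Defs "HOL-Combinatorics.Permutations" "HOL-Library.Disjoint_Sets"
begin

text \<open>
  Let \<open>I\<close> be a maximum independent set and \<open>C\<close> its complement. By Hall's theorem some \<open>f\<close> maps \<open>I\<close> onto
  \<open>C\<close> with every \<open>i\<close> adjacent to \<open>f i\<close>. All edges between \<open>I\<close> and \<open>C\<close> are directed into \<open>C\<close>, so the sums
  on \<open>I\<close> are negative. The \<open>k\<close> edges inside \<open>C\<close> receive the labels \<open>1, \<dots>, k\<close>, decreasing along the
  trails of a decomposition into as few trails as possible; then every vertex starts at most one trail
  and loses at most \<open>k\<close>, which its edge from \<open>I\<close> outweighs, so the sums on \<open>C\<close> are positive.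

  A vertex \<open>i\<close> of \<open>I\<close> has \<open>deg i - 1 \<noteq> 1\<close> edges apart from \<open>(i, f i)\<close>. They split into pairs and
  triples, and are labelled so that every pair sums to \<open>2\<mu>\<close> and every triple to \<open>3\<mu>\<close>, for one \<open>\<mu>\<close>
  exceeding the differences of the remaining labels. Whichever way those labels are distributed among
  the edges \<open>(i, f i)\<close>, the sums on \<open>I\<close> are then distinct. A distribution maximizing the sum of the
  squared vertex sums over \<open>C\<close> makes the sums on \<open>C\<close> distinct as well, since exchanging two labels
  between vertices with equal sums would increase it.
\<close>

subsection \<open>Maximum independent sets\<close>

text \<open>Hall's marriage theorem, by strong induction on \<open>card I\<close>. If some nonempty
  proper subfamily \<open>J\<close> is tight, \<open>J\<close> and \<open>I - J\<close> are matched
  separately; otherwise every nonempty proper subfamily has an element to spare, so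
  \<open>i0\<close> may take any \<open>a\<close> in \<open>A i0\<close>.\<close>

lemma hall:
  assumes "finite I" and "\<And>i. i \<in> I \<Longrightarrow> finite (A i)"
    and "\<And>J. J \<subseteq> I \<Longrightarrow> card J \<le> card (\<Union>i\<in>J. A i)"
  shows "\<exists>R. (\<forall>i\<in>I. R i \<in> A i) \<and> inj_on R I"
  using assms
proof (induction "card I" arbitrary: I A rule: less_induct)
  case less
  show ?case
  proof (cases "I = {}")
    case False
    then obtain i0 where i0: "i0 \<in> I" by blast
    show ?thesis
    proof (cases "\<exists>J. J \<subset> I \<and> J \<noteq> {} \<and> card J = card (\<Union>i\<in>J. A i)")
      case True
      then obtain J where J: "J \<subset> I" "J \<noteq> {}" and cJ: "card J = card (\<Union>i\<in>J. A i)" by blast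
      let ?U = "\<Union>i\<in>J. A i"
      have finJ: "finite J" using J less.prems(1) finite_subset by blast
      have finU: "finite ?U" using finJ J less.prems(2) by blast
      have "\<exists>R. (\<forall>i\<in>J. R i \<in> A i) \<and> inj_on R J"
      proof (rule less.hyps)
        show "card J < card I" using J less.prems(1) by (simp add: psubset_card_mono)
      qed (use J finJ less.prems in auto)
      then obtain R where R: "\<And>i. i \<in> J \<Longrightarrow> R i \<in> A i" "inj_on R J" by blast
      \<comment> \<open>The elements of \<open>?U\<close> are reserved for \<open>J\<close>. Hall's
        condition survives: it holds for \<open>K \<union> J\<close>, and the tight \<open>J\<close>
        accounts for exactly \<open>card ?U\<close> of that union.\<close>
      have "\<exists>R. (\<forall>i\<in>I - J. R i \<in> A i - ?U) \<and> inj_on R (I - J)"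
      proof (rule less.hyps)
        show "card (I - J) < card I"
          using J less.prems(1) by (intro psubset_card_mono) auto
        fix K assume K: "K \<subseteq> I - J"
        have finK: "finite K" using K less.prems(1) finite_subset by blast
        have "card K + card J = card (K \<union> J)"
          using K finJ finK by (subst card_Un_disjoint) auto
        also have "\<dots> \<le> card (\<Union>i\<in>K \<union> J. A i)"
          using K J by (intro less.prems(3)) auto
        also have "(\<Union>i\<in>K \<union> J. A i) = (\<Union>i\<in>K. A i - ?U) \<union> ?U" by blast
        also have "card \<dots> = card (\<Union>i\<in>K. A i - ?U) + card ?U"
          using finU finK K less.prems(2) by (intro card_Un_disjoint) auto
        finally show "card K \<le> card (\<Union>i\<in>K. A i - ?U)" using cJ by simp
      qed (use less.prems in auto)
      then obtain R' where R': "\<And>i. i \<in> I - J \<Longrightarrow> R' i \<in> A i - ?U" "inj_on R' (I - J)" by blast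
      define S where "S i = (if i \<in> J then R i else R' i)" for i
      have "S i \<in> A i" if "i \<in> I" for i using that R R' by (auto simp: S_def)
      moreover have "inj_on S I"
      proof (rule inj_onI)
        fix i j assume ij: "i \<in> I" "j \<in> I" "S i = S j"
        consider "i \<in> J" "j \<in> J" | "i \<in> J" "j \<notin> J" | "i \<notin> J" "j \<in> J" | "i \<notin> J" "j \<notin> J" by blast
        then show "i = j"
        proof cases
          case 1 then show ?thesis using ij R(2) by (auto simp: S_def dest: inj_onD)
        next
          case 2 then show ?thesis using ij R(1)[of i] R'(1)[of j] by (auto simp: S_def)
        next
          case 3 then show ?thesis using ij R(1)[of j] R'(1)[of i] by (auto simp: S_def)
        next
          case 4 then show ?thesis using ij R'(2) by (auto simp: S_def dest: inj_onD)
        qed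
      qed
      ultimately show ?thesis by blast
    next
      case False
      have "card {i0} \<le> card (\<Union>i\<in>{i0}. A i)" using i0 by (intro less.prems(3)) auto
      then obtain a where a: "a \<in> A i0" by (cases "A i0 = {}") auto
      have "\<exists>R. (\<forall>i\<in>I - {i0}. R i \<in> A i - {a}) \<and> inj_on R (I - {i0})"
      proof (rule less.hyps)
        show "card (I - {i0}) < card I" using i0 less.prems(1) by (intro psubset_card_mono) auto
        fix K assume K: "K \<subseteq> I - {i0}"
        show "card K \<le> card (\<Union>i\<in>K. A i - {a})"
        proof (cases "K = {}")
          case False
          have finK: "finite K" using K less.prems(1) finite_subset by blast
          have finA: "finite (\<Union>i\<in>K. A i)" using finK K less.prems(2) by blast
          \<comment> \<open>\<open>K\<close> omits \<open>i0\<close>, so it is a proper subfamily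
            and not tight; deleting \<open>a\<close> costs at most one element.\<close>
          have "card K \<noteq> card (\<Union>i\<in>K. A i)"
            using \<open>\<not> (\<exists>J. _ J)\<close> K i0 False by blast
          moreover have "card K \<le> card (\<Union>i\<in>K. A i)" using K by (intro less.prems(3)) auto
          moreover have "card (\<Union>i\<in>K. A i) \<le> Suc (card ((\<Union>i\<in>K. A i) - {a}))"
            using card_Diff1_le[of "\<Union>i\<in>K. A i" a] finA
            by (cases "a \<in> (\<Union>i\<in>K. A i)") (simp_all add: card_Suc_Diff1 del: UN_iff)
          moreover have "(\<Union>i\<in>K. A i - {a}) = (\<Union>i\<in>K. A i) - {a}" by blast
          ultimately show ?thesis by simp
        qed simp
      qed (use less.prems in auto)
      then obtain R where R: "\<And>i. i \<in> I - {i0} \<Longrightarrow> R i \<in> A i - {a}" "inj_on R (I - {i0})" by blast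
      have "\<forall>i\<in>I. (R(i0 := a)) i \<in> A i" using R a by auto
      moreover have "inj_on (R(i0 := a)) I"
      proof (rule inj_onI)
        fix i j assume ij: "i \<in> I" "j \<in> I" "(R(i0 := a)) i = (R(i0 := a)) j"
        show "i = j"
        proof (cases "i = i0 \<or> j = i0")
          case True then show ?thesis using ij R(1)[of i] R(1)[of j] by (auto split: if_splits)
        next
          case False then show ?thesis using ij inj_onD[OF R(2), of i j] by auto
        qed
      qed
      ultimately show ?thesis by blast
    qed
  qed simp
qed

text \<open>Hall's theorem matches the complement of a maximum independent set into that set, and
  \<open>f\<close> inverts the matching. Bipartiteness yields Hall's condition: a set
  \<open>J\<close> of complement vertices splits into \<open>J \<inter> X\<close> and
  \<open>J \<inter> Y\<close>, which are independent and have disjoint neighbourhoods.\<close>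

lemma ex_independent_set_onto_complement:
  assumes fin: "finite V" and E: "E \<subseteq> V \<times> V" "sym E"
    and XY: "V = X \<union> Y" "X \<inter> Y = {}" "E \<subseteq> X \<times> Y \<union> Y \<times> X"
    and nbr: "\<And>v. v \<in> V \<Longrightarrow> \<exists>w. (v, w) \<in> E"
  obtains I f where "I \<subseteq> V" "\<And>i j. i \<in> I \<Longrightarrow> j \<in> I \<Longrightarrow> (i, j) \<notin> E"
    "\<And>i. i \<in> I \<Longrightarrow> (i, f i) \<in> E" "f ` I = V - I"
proof -
  define indep where "indep I \<longleftrightarrow> I \<subseteq> V \<and> (\<forall>i\<in>I. \<forall>j\<in>I. (i, j) \<notin> E)" for I
  have "indep {}" by (simp add: indep_def)
  moreover have "\<forall>I. indep I \<longrightarrow> card I < Suc (card V)"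
    using fin by (simp add: indep_def card_mono less_Suc_eq_le)
  ultimately obtain I where I: "indep I" and max: "\<And>I'. indep I' \<Longrightarrow> card I' \<le> card I"
    using ex_has_greatest_nat[of indep "{}" card "Suc (card V)"] by metis
  have IV: "I \<subseteq> V" and ind: "\<And>i j. i \<in> I \<Longrightarrow> j \<in> I \<Longrightarrow> (i, j) \<notin> E"
    using I by (auto simp: indep_def)
  have finI: "finite I" using IV fin finite_subset by blast
  let ?N = "\<lambda>c. {i \<in> I. (i, c) \<in> E}"
  \<comment> \<open>Replacing the neighbours in \<open>I\<close> of an independent \<open>J\<close>
    by \<open>J\<close> itself gives another independent set, so by maximality there are at least
    \<open>card J\<close> of them.\<close>
  have side: "card J \<le> card (\<Union>c\<in>J. ?N c)"
    if "J \<subseteq> V - I" "\<And>u v. u \<in> J \<Longrightarrow> v \<in> J \<Longrightarrow> (u, v) \<notin> E" for J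
  proof -
    let ?U = "\<Union>c\<in>J. ?N c"
    have finJ: "finite J" using that(1) fin by (meson finite_Diff finite_subset)
    have finU: "finite ?U" using finI by (rule rev_finite_subset) auto
    have "indep (I - ?U \<union> J)"
      unfolding indep_def
    proof (intro conjI ballI)
      fix u v assume "u \<in> I - ?U \<union> J" "v \<in> I - ?U \<union> J"
      then show "(u, v) \<notin> E" using ind that(2) symD[OF E(2), of u v] by blast
    qed (use that IV in blast)
    then have "card (I - ?U \<union> J) \<le> card I" by (rule max)
    moreover have "card (I - ?U \<union> J) = card (I - ?U) + card J"
      using finI finJ that by (intro card_Un_disjoint) auto
    moreover have "card (I - ?U) = card I - card ?U" using finU by (intro card_Diff_subset) auto
    moreover have "card ?U \<le> card I" using finI by (intro card_mono) auto
    ultimately show ?thesis by linarith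
  qed
  have "\<exists>R. (\<forall>c\<in>V - I. R c \<in> ?N c) \<and> inj_on R (V - I)"
  proof (rule hall)
    fix J assume J: "J \<subseteq> V - I"
    have finJ: "finite J" using J fin by (meson finite_Diff finite_subset)
    have JXY: "J \<inter> X \<union> J \<inter> Y = J" using J XY(1) by blast
    have NX: "(\<Union>c\<in>J \<inter> X. ?N c) \<subseteq> Y" and NY: "(\<Union>c\<in>J \<inter> Y. ?N c) \<subseteq> X"
      using XY(2,3) by blast+
    have finN: "finite (\<Union>c\<in>K. ?N c)" for K using finI by (rule rev_finite_subset) auto
    have "card J = card (J \<inter> X) + card (J \<inter> Y)"
      using XY(2) finJ by (subst card_Un_disjoint[symmetric]) (auto simp: JXY)
    also have "\<dots> \<le> card (\<Union>c\<in>J \<inter> X. ?N c) + card (\<Union>c\<in>J \<inter> Y. ?N c)"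
    proof (rule add_mono; rule side)
      show "(u, v) \<notin> E" if "u \<in> J \<inter> X" "v \<in> J \<inter> X" for u v using that XY(2,3) by blast
      show "(u, v) \<notin> E" if "u \<in> J \<inter> Y" "v \<in> J \<inter> Y" for u v using that XY(2,3) by blast
    qed (use J in auto)
    also have "\<dots> = card ((\<Union>c\<in>J \<inter> X. ?N c) \<union> (\<Union>c\<in>J \<inter> Y. ?N c))"
      using XY(2) NX NY by (intro card_Un_disjoint[symmetric] finN) blast
    also have "\<dots> \<le> card (\<Union>c\<in>J. ?N c)" by (intro card_mono finN) auto
    finally show "card J \<le> card (\<Union>c\<in>J. ?N c)" .
  qed (use fin finI in auto)
  then obtain R where R: "\<And>c. c \<in> V - I \<Longrightarrow> R c \<in> I \<and> (R c, c) \<in> E" "inj_on R (V - I)" by auto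
  \<comment> \<open>Vertices of \<open>I\<close> outside the range of \<open>R\<close> get an
    arbitrary neighbour; by independence it lies in \<open>V - I\<close> as well.\<close>
  define f where "f i = (if i \<in> R ` (V - I) then the_inv_into (V - I) R i else SOME w. (i, w) \<in> E)" for i
  have fR: "f (R c) = c" if "c \<in> V - I" for c using that R(2) by (simp add: f_def the_inv_into_f_f)
  have fE: "(i, f i) \<in> E" if i: "i \<in> I" for i
  proof (cases "i \<in> R ` (V - I)")
    case True then show ?thesis using R(1) fR by auto
  next
    case False
    have "\<exists>w. (i, w) \<in> E" using i IV nbr by blast
    from someI_ex[OF this] False show ?thesis by (simp add: f_def)
  qed
  have "f ` I = V - I"
  proof
    show "f ` I \<subseteq> V - I" using fE ind E(1) by blast
    show "V - I \<subseteq> f ` I" using fR R(1) by (metis image_eqI subsetI)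
  qed
  then show ?thesis using that IV ind fE by blast
qed

subsection \<open>Distinct sums by exchanging labels\<close>

text \<open>Surjectivity gives every element of \<open>C\<close> a label to exchange. An exchange
  between two elements with equal sums \<open>s\<close> turns \<open>2 * s\<^sup>2\<close> into
  \<open>(s + d)\<^sup>2 + (s - d)\<^sup>2 = 2 * s\<^sup>2 + 2 * d\<^sup>2\<close>, where
  \<open>d\<close> is the difference of two distinct labels.\<close>

lemma ex_bij_inj_on_fiber_sums:
  fixes base :: "'c \<Rightarrow> int" and \<Lambda> :: "int set"
  assumes fin: "finite I" and \<Lambda>: "finite \<Lambda>" "card \<Lambda> = card I" and surj: "f ` I = C"
  obtains \<phi> where "bij_betw \<phi> I \<Lambda>" "inj_on (\<lambda>c. base c + (\<Sum>i | i \<in> I \<and> f i = c. \<phi> i)) C"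
proof -
  obtain \<phi>0 where \<phi>0: "bij_betw \<phi>0 I \<Lambda>" using fin \<Lambda> by (metis finite_same_card_bij)
  define s where "s p c = base c + (\<Sum>i | i \<in> I \<and> f i = c. \<phi>0 (p i))" for p c
  define \<Phi> where "\<Phi> p = (\<Sum>c\<in>C. (s p c)\<^sup>2)" for p
  let ?P = "{p. p permutes I}"
  have finP: "finite ?P" "?P \<noteq> {}" using fin finite_permutations permutes_id by blast+
  then have "Max (\<Phi> ` ?P) \<in> \<Phi> ` ?P" by (intro Max_in) auto
  then obtain p where p: "p permutes I" and "\<Phi> p = Max (\<Phi> ` ?P)" by auto
  then have max: "\<Phi> p' \<le> \<Phi> p" if "p' permutes I" for p' using finP that by simp
  have bij: "bij_betw (\<phi>0 \<circ> p) I \<Lambda>" using \<phi>0 p bij_betw_trans permutes_imp_bij by blast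
  have finC: "finite C" using surj fin by blast
  have "inj_on (s p) C"
  proof (rule inj_onI, rule ccontr)
    fix u v assume uv: "u \<in> C" "v \<in> C" "s p u = s p v" "u \<noteq> v"
    obtain i j where i: "i \<in> I" "f i = u" and j: "j \<in> I" "f j = v" using uv surj by blast
    \<comment> \<open>Composing with the transposition exchanges the labels of \<open>i\<close> and
      \<open>j\<close>, which affects only the sums at \<open>u\<close> and
      \<open>v\<close>.\<close>
    define p' where "p' = p \<circ> transpose i j"
    have p': "p' permutes I" unfolding p'_def using i j p by (intro permutes_compose permutes_swap_id)
    define d where "d = \<phi>0 (p j) - \<phi>0 (p i)"
    have "i \<noteq> j" using i j uv by auto
    then have "d \<noteq> 0" using bij i j by (auto simp: d_def bij_betw_def inj_on_def)
    have su: "s p' u = s p u + d"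
    proof -
      have *: "{k \<in> I. f k = u} = insert i ({k \<in> I. f k = u} - {i})" using i by blast
      have "(\<Sum>k\<in>{k \<in> I. f k = u} - {i}. \<phi>0 (p' k)) = (\<Sum>k\<in>{k \<in> I. f k = u} - {i}. \<phi>0 (p k))"
        using j uv by (intro sum.cong) (auto simp: p'_def transpose_def)
      then show ?thesis unfolding s_def using fin
        by (subst (1 2) *, subst (1 2) sum.insert) (auto simp: p'_def d_def)
    qed
    have sv: "s p' v = s p v - d"
    proof -
      have *: "{k \<in> I. f k = v} = insert j ({k \<in> I. f k = v} - {j})" using j by blast
      have "(\<Sum>k\<in>{k \<in> I. f k = v} - {j}. \<phi>0 (p' k)) = (\<Sum>k\<in>{k \<in> I. f k = v} - {j}. \<phi>0 (p k))"
        using i uv by (intro sum.cong) (auto simp: p'_def transpose_def)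
      then show ?thesis unfolding s_def using fin
        by (subst (1 2) *, subst (1 2) sum.insert) (auto simp: p'_def d_def)
    qed
    have so: "s p' c = s p c" if "c \<noteq> u" "c \<noteq> v" for c
      unfolding s_def using that i j
      by (intro arg_cong2[where f = "(+)"] sum.cong) (auto simp: p'_def transpose_def)
    have *: "C = insert u (insert v (C - {u, v}))" using uv by blast
    have split: "\<Phi> r = (s r u)\<^sup>2 + ((s r v)\<^sup>2 + (\<Sum>c\<in>C - {u, v}. (s r c)\<^sup>2))" for r
      unfolding \<Phi>_def using uv finC by (subst *, subst sum.insert) auto
    have "(\<Sum>c\<in>C - {u, v}. (s p' c)\<^sup>2) = (\<Sum>c\<in>C - {u, v}. (s p c)\<^sup>2)"
      by (intro sum.cong) (auto simp: so)
    then have "\<Phi> p' = \<Phi> p + 2 * d\<^sup>2"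
      unfolding split su sv uv(3) by (simp add: power2_eq_square algebra_simps)
    moreover have "d\<^sup>2 > 0" using \<open>d \<noteq> 0\<close> by simp
    ultimately show False using max[OF p'] by linarith
  qed
  then show ?thesis using that[OF bij] by (simp add: s_def[abs_def])
qed

subsection \<open>Labelling along trails\<close>

text \<open>This and \<open>orients\<close> are the counterparts of
  \<open>oriented_vertex_sum\<close> and \<open>orientation_of\<close> for bare sets of pairs, so
  that they also apply to the edges inside \<open>C\<close> alone.\<close>

definition net_sum :: "('a \<times> 'a) set \<Rightarrow> ('a \<times> 'a \<Rightarrow> int) \<Rightarrow> 'a \<Rightarrow> int" where
  "net_sum D \<sigma> v = (\<Sum>a | a \<in> D \<and> snd a = v. \<sigma> a) - (\<Sum>a | a \<in> D \<and> fst a = v. \<sigma> a)"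

definition orients :: "('a \<times> 'a) set \<Rightarrow> ('a \<times> 'a) set \<Rightarrow> bool" where
  "orients D E \<longleftrightarrow> D \<subseteq> E \<and> (\<forall>(u, v)\<in>E. (u, v) \<in> D \<longleftrightarrow> (v, u) \<notin> D)"

text \<open>Every edge is directed upwards along an injective numbering of the vertices.\<close>

lemma orients_exists:
  assumes "finite E" "sym E" "irrefl E"
  shows "\<exists>D. orients D E"
proof -
  obtain g :: "_ \<Rightarrow> nat" where g: "inj_on g (Field E)"
    using finite_imp_inj_to_nat_seg[OF finite_Field[OF assms(1)]] by blast
  have "g u \<noteq> g v" if "(u, v) \<in> E" for u v
  proof
    assume "g u = g v"
    then have "u = v" using that g by (auto simp: inj_on_def Field_def)
    then show False using that assms(3) by (simp add: irrefl_def)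
  qed
  then have "orients {(u, v) \<in> E. g u < g v} E"
    using symD[OF assms(2)] by (force simp: orients_def)
  then show ?thesis by blast
qed

text \<open>Serves to reverse a segment \<open>B\<close> of an arc list \<open>A @ B @ C\<close>. An
  orientation never contains both directions of an edge, so the reversed arcs are new and the list
  stays distinct.\<close>

lemma orients_flip:
  assumes "orients (A \<union> B \<union> C) E" "sym E" "A \<inter> B = {}" "B \<inter> C = {}"
  shows "orients (A \<union> prod.swap ` B \<union> C) E"
    and "prod.swap ` B \<inter> (A \<union> B \<union> C) = {}"
proof -
  have mem: "(u, v) \<in> prod.swap ` B \<longleftrightarrow> (v, u) \<in> B" for u v by force
  have D: "A \<union> B \<union> C \<subseteq> E"
    "\<And>u v. (u, v) \<in> E \<Longrightarrow> (u, v) \<in> A \<union> B \<union> C \<longleftrightarrow> (v, u) \<notin> A \<union> B \<union> C"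
    using assms(1) unfolding orients_def by blast+
  have "(u, v) \<notin> A \<union> B \<union> C" if "(v, u) \<in> B" for u v
  proof
    assume uv: "(u, v) \<in> A \<union> B \<union> C"
    then have "(v, u) \<notin> A \<union> B \<union> C" using D(1) D(2)[of u v] by blast
    then show False using that by blast
  qed
  then show "prod.swap ` B \<inter> (A \<union> B \<union> C) = {}" using mem by fast
  have "prod.swap ` B \<subseteq> E" using D(1) symD[OF assms(2)] by auto
  moreover have "(u, v) \<in> A \<union> prod.swap ` B \<union> C \<longleftrightarrow> (v, u) \<notin> A \<union> prod.swap ` B \<union> C"
    if "(u, v) \<in> E" for u v
    using D(2)[OF that] assms(3,4) by (simp only: Un_iff mem) blast
  ultimately show "orients (A \<union> prod.swap ` B \<union> C) E" using D(1) unfolding orients_def by blast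
qed

text \<open>A nonempty list of distinct arcs is read as a concatenation of trails, cut wherever an
  arc does not start at the head of its predecessor. Fewest breaks means fewest trails.\<close>

fun breaks :: "('a \<times> 'a) list \<Rightarrow> nat" where
  "breaks (a # b # xs) = (if snd a = fst b then 0 else 1) + breaks (b # xs)"
| "breaks xs = 0"

lemma breaks_append:
  "xs \<noteq> [] \<Longrightarrow> ys \<noteq> [] \<Longrightarrow>
    breaks (xs @ ys) = breaks xs + (if snd (last xs) = fst (hd ys) then 0 else 1) + breaks ys"
proof (induction xs rule: breaks.induct)
  case ("2_2" v)
  then show ?case by (cases ys) auto
qed auto

text \<open>A trail traversed backwards, with all its arcs reversed, is again a trail.\<close>

lemma breaks_reverse: "breaks (rev (map prod.swap xs)) = breaks xs"
proof (induction xs rule: breaks.induct)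
  case (1 a b xs)
  have "rev (map prod.swap (a # b # xs)) = rev (map prod.swap (b # xs)) @ [prod.swap a]" by simp
  moreover have "breaks (rev (map prod.swap (b # xs)) @ [prod.swap a]) =
      breaks (rev (map prod.swap (b # xs))) + (if fst b = snd a then 0 else 1)"
    by (subst breaks_append) simp_all
  ultimately show ?case using 1 by (simp only: breaks.simps) auto
qed auto

text \<open>Labels fall by one at each step of a list \<open>L\<close> with fewest breaks. An arc
  leaving \<open>v\<close> inside a trail is preceded by an arc entering \<open>v\<close> with a
  larger label, so only a trail starting at \<open>v\<close> can cause a loss. Minimality allows one
  such trail per vertex, and its first label is at most \<open>k\<close>.\<close>

lemma ex_orients_net_sum_ge:
  assumes "finite E" "sym E" "irrefl E"
  obtains D \<sigma> where "orients D E" "bij_betw \<sigma> D {1..int (card D)}"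
    "\<And>v. net_sum D \<sigma> v \<ge> - int (card D)"
proof -
  define P where "P L \<longleftrightarrow> distinct L \<and> orients (set L) E" for L
  obtain D where D: "orients D E" using orients_exists assms by blast
  then have "finite D" using assms(1) finite_subset by (auto simp: orients_def)
  then obtain L0 where "P L0" using D finite_distinct_list P_def by blast
  then obtain L where L: "P L" and min: "\<And>L'. P L' \<Longrightarrow> breaks L \<le> breaks L'"
    using ex_has_least_nat[of P L0 breaks] by blast
  have dL: "distinct L" and oL: "orients (set L) E" using L by (auto simp: P_def)
  \<comment> \<open>Position \<open>i\<close> opens a trail at \<open>v\<close>: it is the first
    position, or the preceding arc ends elsewhere.\<close>
  define start where "start v i \<longleftrightarrow> i < length L \<and> fst (L ! i) = v \<and> (i = 0 \<or> snd (L ! (i - 1)) \<noteq> v)" for v i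
  \<comment> \<open>With trails opening at \<open>v\<close> at positions \<open>i < j\<close>, the
    segment \<open>B\<close> between them is reversed. It then ends at \<open>v\<close> and joins
    \<open>C\<close>, which removes the break before \<open>C\<close>; a break before
    \<open>B\<close> existed already unless \<open>A\<close> is empty. So the number of breaks
    drops.\<close>
  have no_two: False if ij: "i < j" "start v i" "start v j" for v i j
  proof -
    define A B C where "A = take i L" and "B = drop i (take j L)" and "C = drop j L"
    have LABC: "L = A @ B @ C"
    proof -
      have "take j L = A @ B"
        using append_take_drop_id[of i "take j L"] ij(1) by (simp add: A_def B_def min_absorb1)
      then show ?thesis using append_take_drop_id[of j L] by (simp add: C_def)
    qed
    have j: "j < length L" using ij by (simp add: start_def)
    have ne: "B \<noteq> []" "C \<noteq> []" using ij(1) j by (auto simp: B_def C_def)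
    have hB: "fst (hd B) = v"
      using ij j by (auto simp: B_def start_def hd_drop_conv_nth)
    have hC: "fst (hd C) = v"
      using ij j by (auto simp: C_def start_def hd_drop_conv_nth)
    have lB: "snd (last B) \<noteq> v"
      using ij j by (auto simp: B_def start_def last_drop last_conv_nth)
    have lA: "snd (last A) \<noteq> v" if "A \<noteq> []"
      using ij j that by (auto simp: A_def start_def last_conv_nth)
    define B' where "B' = rev (map prod.swap B)"
    have setB': "set B' = prod.swap ` set B" by (simp add: B'_def)
    have "orients (set A \<union> set B \<union> set C) E" using oL LABC by (simp add: Un_assoc)
    note flip = orients_flip[OF this assms(2)]
    have "P (A @ B' @ C)"
      using flip dL LABC unfolding P_def setB'[symmetric]
      by (auto simp: Un_assoc B'_def distinct_map)
    then have "breaks L \<le> breaks (A @ B' @ C)" by (rule min)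
    moreover have "breaks (B' @ C) < breaks (B @ C)"
      using ne hB hC lB by (simp add: breaks_append breaks_reverse B'_def last_rev hd_map)
    moreover have "breaks (A @ B' @ C) \<le> breaks A + 1 + breaks (B' @ C)" if "A \<noteq> []"
      using that ne by (subst breaks_append) (auto simp: B'_def)
    moreover have "breaks (A @ B @ C) = breaks A + 1 + breaks (B @ C)" if "A \<noteq> []"
      using that ne lA hB by (subst breaks_append) auto
    ultimately show False unfolding LABC by (cases "A = []") (simp, linarith)
  qed
  define k where "k = length L"
  have k: "k = card (set L)" using dL by (simp add: k_def distinct_card)
  have bij_nth: "bij_betw ((!) L) {..<k} (set L)" using dL by (simp add: bij_betw_nth k_def)
  \<comment> \<open>Positions count from 0, so the labels run from \<open>k\<close> down to
    1.\<close>
  define \<sigma> where "\<sigma> a = int k - int (the_inv_into {..<k} ((!) L) a)" for a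
  have \<sigma>: "\<sigma> (L ! i) = int k - int i" if "i < k" for i
    using that bij_nth by (simp add: \<sigma>_def the_inv_into_f_f bij_betw_def)
  have reindex: "(\<Sum>a | a \<in> set L \<and> Q a. \<sigma> a) = (\<Sum>i | i < k \<and> Q (L ! i). int k - int i)" for Q
  proof -
    have im: "{a \<in> set L. Q a} = (!) L ` {i. i < k \<and> Q (L ! i)}"
      unfolding k_def set_conv_nth by blast
    have "inj_on ((!) L) {i. i < k \<and> Q (L ! i)}"
      using bij_nth by (auto simp: bij_betw_def intro: inj_on_subset)
    then show ?thesis unfolding im by (subst sum.reindex) (simp_all add: \<sigma>)
  qed
  show ?thesis
  proof (rule that[OF oL])
    have "bij_betw (\<lambda>i. int k - int i) {..<k} {1..int k}"
      by (rule bij_betw_byWitness[where f' = "\<lambda>x. nat (int k - x)"]) auto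
    then have "bij_betw (\<sigma> \<circ> (!) L) {..<k} {1..int k}"
      by (rule bij_betw_cong[THEN iffD1, rotated]) (simp add: \<sigma>)
    then show "bij_betw \<sigma> (set L) {1..int (card (set L))}"
      using bij_betw_comp_iff[OF bij_nth, of \<sigma> "{1..int k}"] k by simp
    fix v
    let ?O = "{i. i < k \<and> fst (L ! i) = v}" and ?S = "{i. start v i}"
    have SO: "?S \<subseteq> ?O" by (auto simp: start_def k_def)
    have finO: "finite ?O" by simp
    have "(\<Sum>i\<in>?S. int k - int i) \<le> int k"
    proof (cases "?S = {}")
      case False
      then obtain i where i: "i \<in> ?S" by blast
      have "j = i" if "start v j" for j
        using no_two[of i j v] no_two[of j i v] i that by (metis linorder_neqE_nat mem_Collect_eq)
      then have "?S = {i}" using i by blast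
      then show ?thesis by simp
    qed simp
    \<comment> \<open>Each departure from \<open>v\<close> that opens no trail is charged to the
      arrival one position earlier.\<close>
    moreover have "(\<Sum>i\<in>?O - ?S. int k - int i) \<le> (\<Sum>i | i < k \<and> snd (L ! i) = v. int k - int i)"
    proof -
      have pos: "i > 0" "snd (L ! (i - 1)) = v" if "i \<in> ?O - ?S" for i
        using that by (auto simp: start_def k_def)
      have "(\<Sum>i\<in>?O - ?S. int k - int i) \<le> (\<Sum>i\<in>?O - ?S. int k - int (i - 1))"
        by (intro sum_mono) auto
      also have "\<dots> = (\<Sum>i\<in>(\<lambda>i. i - 1) ` (?O - ?S). int k - int i)"
      proof (subst sum.reindex)
        \<comment> \<open>Truncated subtraction identifies 0 with 1, but a departure at position 0
          opens a trail and is excluded.\<close>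
        show "inj_on (\<lambda>i. i - 1) (?O - ?S)"
        proof (rule inj_onI)
          fix i j assume "i \<in> ?O - ?S" "j \<in> ?O - ?S" "i - 1 = j - 1"
          with pos(1)[of i] pos(1)[of j] show "i = j" by arith
        qed
      qed simp
      also have "\<dots> \<le> (\<Sum>i | i < k \<and> snd (L ! i) = v. int k - int i)"
      proof (rule sum_mono2)
        show "(\<lambda>i. i - 1) ` (?O - ?S) \<subseteq> {i. i < k \<and> snd (L ! i) = v}"
        proof (rule image_subsetI)
          fix i assume i: "i \<in> ?O - ?S"
          then have "i < k" by simp
          then show "i - 1 \<in> {i. i < k \<and> snd (L ! i) = v}" using pos(2)[OF i] by simp
        qed
      qed auto
      finally show ?thesis .
    qed
    moreover have "(\<Sum>i\<in>?O. int k - int i) = (\<Sum>i\<in>?O - ?S. int k - int i) + (\<Sum>i\<in>?S. int k - int i)"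
      using SO finO by (rule sum.subset_diff)
    ultimately show "net_sum (set L) \<sigma> v \<ge> - int (card (set L))"
      using reindex[of "\<lambda>a. snd a = v"] reindex[of "\<lambda>a. fst a = v"] k
      unfolding net_sum_def by linarith
  qed
qed

subsection \<open>Zero-sum pairs and triples\<close>

text \<open>Splits the \<open>6 * q + 3\<close> integers of absolute value at most
  \<open>3 * q + 1\<close> into zero-sum triples, with \<open>x\<close>, \<open>y\<close>,
  \<open>z\<close> ranging over the middle, upper and lower third. While \<open>y\<close> increases
  by 1, \<open>x\<close> decreases by 2, first through the parity class of \<open>q\<close> and then
  through the other; hence \<open>z\<close> increases by 1 apart from one jump, and repeats
  nothing.\<close>

lemma zero_sum_triples_index:
  fixes q :: nat
  obtains x y z :: "nat \<Rightarrow> int" and j0 where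
    "\<And>j. x j + y j + z j = 0" "j0 < 2 * q + 1" "x j0 = 0"
    "inj_on x {..<2 * q + 1}" "inj_on y {..<2 * q + 1}" "inj_on z {..<2 * q + 1}"
    "\<And>j. j < 2 * q + 1 \<Longrightarrow> x j \<in> {- int q..int q}"
    "\<And>j. j < 2 * q + 1 \<Longrightarrow> y j \<in> {int q + 1..3 * int q + 1}"
    "\<And>j. j < 2 * q + 1 \<Longrightarrow> z j \<in> {- 3 * int q - 1..- int q - 1}"
proof -
  define x where "x j = (if j \<le> q then int q else 3 * int q + 1) - 2 * int j" for j
  define y where "y j = int q + 1 + int j" for j
  \<comment> \<open>The zero of \<open>x\<close> lies in the first run if \<open>q\<close> is even
    and in the second if \<open>q\<close> is odd.\<close>
  define j0 where "j0 = (if even q then q div 2 else (3 * q + 1) div 2)"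
  show ?thesis
  proof (rule that[of x y "\<lambda>j. - x j - y j" j0])
    show "x j0 = 0" unfolding x_def j0_def by (auto split: if_splits) presburger+
    show "j0 < 2 * q + 1" unfolding j0_def by (auto elim!: oddE)
    show "inj_on x {..<2 * q + 1}"
    proof (rule inj_onI)
      fix i j assume "x i = x j"
      then show "i = j" unfolding x_def by (auto split: if_splits) presburger+
    qed
    show "inj_on y {..<2 * q + 1}" by (auto simp: inj_on_def y_def)
    show "inj_on (\<lambda>j. - x j - y j) {..<2 * q + 1}"
      by (auto simp: inj_on_def x_def y_def split: if_splits)
  qed (auto simp: x_def y_def)
qed

text \<open>The prescribed element with offset \<open>0\<close> is what lets an even number of triples be treated as an
  odd number of triples from which a triple or a single element is removed.\<close>

lemma zero_sum_triples:
  fixes \<T> :: "'b set set"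
  assumes card: "card \<T> = 2 * q + 1" and disj: "disjoint \<T>" and three: "\<And>S. S \<in> \<T> \<Longrightarrow> card S = 3"
    and S0: "S0 \<in> \<T>" "e0 \<in> S0"
  obtains g :: "'b \<Rightarrow> int" where "bij_betw g (\<Union>\<T>) {- 3 * int q - 1..3 * int q + 1}"
    "\<And>S. S \<in> \<T> \<Longrightarrow> sum g S = 0" "g e0 = 0"
proof -
  have fin: "finite \<T>" using card card.infinite by fastforce
  obtain x y z :: "nat \<Rightarrow> int" and j0 where sum0: "\<And>j. x j + y j + z j = 0"
    and j0: "j0 < 2 * q + 1" "x j0 = 0"
    and inj: "inj_on x {..<2 * q + 1}" "inj_on y {..<2 * q + 1}" "inj_on z {..<2 * q + 1}"
    and x: "\<And>j. j < 2 * q + 1 \<Longrightarrow> x j \<in> {- int q..int q}"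
    and y: "\<And>j. j < 2 * q + 1 \<Longrightarrow> y j \<in> {int q + 1..3 * int q + 1}"
    and z: "\<And>j. j < 2 * q + 1 \<Longrightarrow> z j \<in> {- 3 * int q - 1..- int q - 1}"
    by (rule zero_sum_triples_index[of q]) blast
  \<comment> \<open>Index \<open>j0\<close> is kept for \<open>S0\<close>; as \<open>e0\<close> will
    be listed first in \<open>S0\<close>, it receives \<open>x j0 = 0\<close>.\<close>
  have "card (\<T> - {S0}) = card ({..<2 * q + 1} - {j0})" using card S0(1) j0(1) fin by simp
  then obtain h0 where h0: "bij_betw h0 (\<T> - {S0}) ({..<2 * q + 1} - {j0})"
    using finite_same_card_bij fin by (metis finite_Diff finite_lessThan)
  define h where "h = h0(S0 := j0)"
  have h_lt: "h S < 2 * q + 1" if "S \<in> \<T>" for S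
    using that h0 j0 by (auto simp: h_def bij_betw_def)
  have h_inj: "S = S'" if "S \<in> \<T>" "S' \<in> \<T>" "h S = h S'" for S S'
    using that h0 by (auto simp: h_def bij_betw_def inj_on_def split: if_splits)
  have "\<exists>a b c. S = {a, b, c} \<and> a \<noteq> b \<and> a \<noteq> c \<and> b \<noteq> c \<and> (S = S0 \<longrightarrow> a = e0)"
    if S: "S \<in> \<T>" for S
  proof -
    obtain a where a: "a \<in> S" "S = S0 \<longrightarrow> a = e0" 
      using three[OF S] S0 by (cases "S = S0") (auto simp: card_3_iff)
    have "card (S - {a}) = 2" using three[OF S] a by simp
    then obtain b c where "S - {a} = {b, c}" "b \<noteq> c" by (auto simp: card_2_iff)
    then have "S = {a, b, c} \<and> a \<noteq> b \<and> a \<noteq> c \<and> b \<noteq> c" using a by blast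
    then show ?thesis using a by blast
  qed
  then obtain a b c where abc: "\<And>S. S \<in> \<T> \<Longrightarrow> S = {a S, b S, c S}"
    and ne: "\<And>S. S \<in> \<T> \<Longrightarrow> a S \<noteq> b S \<and> a S \<noteq> c S \<and> b S \<noteq> c S" and a0: "a S0 = e0"
    using S0 by metis
  define piece where "piece e = (THE S. S \<in> \<T> \<and> e \<in> S)" for e
  have piece: "piece e = S" if "S \<in> \<T>" "e \<in> S" for e S
    unfolding piece_def using that disj by (intro the_equality) (auto simp: disjoint_def)
  define g where "g e = (let S = piece e in
    if e = a S then x (h S) else if e = b S then y (h S) else z (h S))" for e
  have g: "g (a S) = x (h S)" "g (b S) = y (h S)" "g (c S) = z (h S)" if S: "S \<in> \<T>" for S
  proof -
    have "a S \<in> S" "b S \<in> S" "c S \<in> S" using abc[OF S] by auto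
    then have "piece (a S) = S" "piece (b S) = S" "piece (c S) = S" using piece S by auto
    then show "g (a S) = x (h S)" "g (b S) = y (h S)" "g (c S) = z (h S)"
      using ne[OF S] by (auto simp: g_def)
  qed
  have U: "\<Union>\<T> = a ` \<T> \<union> b ` \<T> \<union> c ` \<T>" using abc by blast
  have "inj_on g (\<Union>\<T>)"
  proof (rule inj_onI)
    fix e e' assume "e \<in> \<Union>\<T>" "e' \<in> \<Union>\<T>" and eq: "g e = g e'"
    then obtain S S' where S: "S \<in> \<T>" "e \<in> S" and S': "S' \<in> \<T>" "e' \<in> S'" by blast
    have e: "e = a S \<or> e = b S \<or> e = c S" using S abc by blast
    have e': "e' = a S' \<or> e' = b S' \<or> e' = c S'" using S' abc by blast
    have lt: "h S < 2 * q + 1" "h S' < 2 * q + 1" using h_lt S(1) S'(1) by blast+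
    \<comment> \<open>The three ranges are disjoint, so equal offsets come from the same slot, and
      by injectivity from the same index.\<close>
    have "x (h S) \<noteq> y (h S')" "y (h S) \<noteq> x (h S')" "x (h S) \<noteq> z (h S')"
      "z (h S) \<noteq> x (h S')" "y (h S) \<noteq> z (h S')" "z (h S) \<noteq> y (h S')"
      using x[OF lt(1)] y[OF lt(1)] z[OF lt(1)] x[OF lt(2)] y[OF lt(2)] z[OF lt(2)] by auto
    moreover have "x (h S) = x (h S') \<Longrightarrow> h S = h S'" "y (h S) = y (h S') \<Longrightarrow> h S = h S'"
      "z (h S) = z (h S') \<Longrightarrow> h S = h S'"
      using inj lt by (simp_all add: inj_on_eq_iff)
    ultimately have "h S = h S' \<and>
        (e = a S \<and> e' = a S' \<or> e = b S \<and> e' = b S' \<or> e = c S \<and> e' = c S')"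
      using e e' eq g[OF S(1)] g[OF S'(1)] by metis
    then show "e = e'" using h_inj S(1) S'(1) by blast
  qed
  moreover have "g ` \<Union>\<T> = {- 3 * int q - 1..3 * int q + 1}"
  proof (rule card_subset_eq)
    show "g ` \<Union>\<T> \<subseteq> {- 3 * int q - 1..3 * int q + 1}"
    proof (rule image_subsetI)
      fix e assume "e \<in> \<Union>\<T>"
      then obtain S where S: "S \<in> \<T>" "e = a S \<or> e = b S \<or> e = c S" unfolding U by blast
      have "g e = x (h S) \<or> g e = y (h S) \<or> g e = z (h S)" using S(2) g[OF S(1)] by metis
      then show "g e \<in> {- 3 * int q - 1..3 * int q + 1}"
        using x[OF h_lt[OF S(1)]] y[OF h_lt[OF S(1)]] z[OF h_lt[OF S(1)]] by auto
    qed
    have "card (\<Union>\<T>) = sum card \<T>"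
      using disj three by (intro card_Union_disjoint) (auto simp: card_ge_0_finite)
    then show "card (g ` \<Union>\<T>) = card {- 3 * int q - 1..3 * int q + 1}"
      using calculation three card by (simp add: card_image)
  qed simp
  ultimately have "bij_betw g (\<Union>\<T>) {- 3 * int q - 1..3 * int q + 1}" by (simp add: bij_betw_def)
  moreover have "sum g S = 0" if "S \<in> \<T>" for S
    using ne[OF that] g[OF that] sum0[of "h S"] by (subst abc[OF that]) simp
  moreover have "g e0 = 0" using g(1)[OF S0(1)] a0 j0 by (simp add: h_def)
  ultimately show ?thesis using that by blast
qed

text \<open>Each further pair takes the two values just outside the current symmetric interval.
  \<open>Z\<close> records whether 0 is left out.\<close>

lemma extend_offsets_by_pairs:
  fixes g :: "'b \<Rightarrow> int"
  assumes "finite \<Q>" "\<P> \<inter> \<Q> = {}" "disjoint (\<P> \<union> \<Q>)" "\<And>S. S \<in> \<Q> \<Longrightarrow> card S = 2"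
    and "bij_betw g (\<Union>\<P>) ({- L..L} - Z)" "L \<ge> 0" "Z \<subseteq> {0}" "\<And>S. S \<in> \<P> \<Longrightarrow> sum g S = 0"
  shows "\<exists>g' L'. L' \<ge> (0::int) \<and> bij_betw g' (\<Union>(\<P> \<union> \<Q>)) ({- L'..L'} - Z) \<and> (\<forall>S\<in>\<P> \<union> \<Q>. sum g' S = 0)"
  using assms
proof (induction \<Q> rule: finite_induct)
  case empty
  then show ?case by auto
next
  case (insert Q \<Q>)
  have "disjoint (\<P> \<union> \<Q>)" using insert.prems(2) by (rule pairwise_subset) blast
  then have "\<exists>g' L'. L' \<ge> 0 \<and> bij_betw g' (\<Union>(\<P> \<union> \<Q>)) ({- L'..L'} - Z) \<and> (\<forall>S\<in>\<P> \<union> \<Q>. sum g' S = 0)"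
    using insert.prems by (intro insert.IH) simp_all
  then obtain g' L' where g': "L' \<ge> 0" "bij_betw g' (\<Union>(\<P> \<union> \<Q>)) ({- L'..L'} - Z)"
    "\<forall>S\<in>\<P> \<union> \<Q>. sum g' S = 0" by (elim exE conjE)
  obtain a b where Q: "Q = {a, b}" "a \<noteq> b" using insert.prems(3) by (metis card_2_iff insertI1)
  have notin: "S \<inter> Q = {}" if "S \<in> \<P> \<union> \<Q>" for S
  proof (rule disjointD[OF insert.prems(2)])
    show "S \<noteq> Q" using insert.prems(1) insert.hyps(2) that by blast
  qed (use that in auto)
  then have ab: "a \<notin> \<Union>(\<P> \<union> \<Q>)" "b \<notin> \<Union>(\<P> \<union> \<Q>)" using Q by blast+
  define h where "h = g'(a := L' + 1, b := - L' - 1)"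
  have h: "h e = g' e" if "e \<in> \<Union>(\<P> \<union> \<Q>)" for e using that ab by (auto simp: h_def)
  have "bij_betw h (\<Union>(\<P> \<union> \<Q>)) ({- L'..L'} - Z)"
    using bij_betw_cong[of "\<Union>(\<P> \<union> \<Q>)" h g'] h g'(2) by metis
  moreover have "bij_betw h {a, b} {L' + 1, - L' - 1}"
    using Q(2) g'(1) by (auto simp: bij_betw_def h_def)
  ultimately have "bij_betw h (\<Union>(\<P> \<union> \<Q>) \<union> {a, b}) (({- L'..L'} - Z) \<union> {L' + 1, - L' - 1})"
    by (rule bij_betw_combine) (use g'(1) in auto)
  moreover have "\<Union>(\<P> \<union> \<Q>) \<union> {a, b} = \<Union>(\<P> \<union> insert Q \<Q>)" using Q by auto
  moreover have "({- L'..L'} - Z) \<union> {L' + 1, - L' - 1} = {- (L' + 1)..L' + 1} - Z"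
    using g'(1) insert.prems(6) by auto
  moreover have "sum h S = 0" if "S \<in> \<P> \<union> insert Q \<Q>" for S
  proof (cases "S = Q")
    case True
    then show ?thesis using Q by (simp add: h_def)
  next
    case False
    then have S: "S \<in> \<P> \<union> \<Q>" using that by blast
    then have "sum h S = sum g' S" by (intro sum.cong refl h) blast
    then show ?thesis using bspec[OF g'(3) S] by simp
  qed
  ultimately have "0 \<le> L' + 1 \<and> bij_betw h (\<Union>(\<P> \<union> insert Q \<Q>)) ({- (L' + 1)..L' + 1} - Z) \<and>
      (\<forall>S\<in>\<P> \<union> insert Q \<Q>. sum h S = 0)" using g'(1) by simp
  then show ?case by blast
qed

text \<open>The second alternative, an even number of triples and no pair, leaves a triple of gaps.\<close>

lemma zero_sum_offsets:
  fixes \<P> :: "'b set set"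
  assumes fin: "finite \<P>" and disj: "disjoint \<P>" and card: "\<And>S. S \<in> \<P> \<Longrightarrow> card S = 2 \<or> card S = 3"
  obtains g :: "'b \<Rightarrow> int" and L where "L \<ge> 0" "inj_on g (\<Union>\<P>)" "g ` \<Union>\<P> \<subseteq> {- L..L}"
    "\<And>S. S \<in> \<P> \<Longrightarrow> sum g S = 0"
    "{1..L} \<subseteq> g ` \<Union>\<P> \<and> 2 * L \<le> int (card (\<Union>\<P>)) \<or>
     \<P> \<noteq> {} \<and> (\<forall>S\<in>\<P>. card S = 3) \<and> 2 * L \<le> int (card (\<Union>\<P>)) + 2"
proof -
  define \<T> where "\<T> = {S \<in> \<P>. card S = 3}"
  define \<Q> where "\<Q> = {S \<in> \<P>. card S = 2}"
  have \<P>: "\<P> = \<T> \<union> \<Q>" "\<T> \<inter> \<Q> = {}" using card by (auto simp: \<T>_def \<Q>_def)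
  have TP: "\<T> \<subseteq> \<P>" and card2: "\<And>S. S \<in> \<P> - \<T> \<Longrightarrow> card S = 2"
    using card by (auto simp: \<T>_def)
  have finT: "finite \<T>" using fin by (simp add: \<T>_def)
  have disjT: "disjoint \<T>" using disj by (rule pairwise_subset) (auto simp: \<T>_def)
  note result = that
  \<comment> \<open>Once all triples are served, the remaining pairs extend the interval. At most 0
    is missing from it, which gives the first alternative.\<close>
  have finish: thesis
    if "bij_betw g (\<Union>\<P>') ({- L..L} - Z)" "L \<ge> 0" "Z \<subseteq> {0}" "\<And>S. S \<in> \<P>' \<Longrightarrow> sum g S = 0"
      "\<P>' \<subseteq> \<P>" "\<And>S. S \<in> \<P> - \<P>' \<Longrightarrow> card S = 2" for g :: "'b \<Rightarrow> int" and L Z \<P>'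
  proof -
    have eq: "\<P>' \<union> (\<P> - \<P>') = \<P>" using that(5) by blast
    have "\<exists>g' L'. L' \<ge> (0::int) \<and> bij_betw g' (\<Union>(\<P>' \<union> (\<P> - \<P>'))) ({- L'..L'} - Z) \<and>
        (\<forall>S\<in>\<P>' \<union> (\<P> - \<P>'). sum g' S = 0)"
      using that fin disj by (intro extend_offsets_by_pairs) (auto simp: Un_absorb1)
    then obtain g' L' where g': "L' \<ge> (0::int)" "bij_betw g' (\<Union>\<P>) ({- L'..L'} - Z)"
      "\<And>S. S \<in> \<P> \<Longrightarrow> sum g' S = 0" unfolding eq by blast
    have "card (\<Union>\<P>) = card ({- L'..L'} - Z)" using g'(2) by (rule bij_betw_same_card)
    moreover have "card ({- L'..L'} - {0}) \<le> card ({- L'..L'} - Z)" using that(3) by (intro card_mono) auto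
    moreover have "card ({- L'..L'} - {0}) = nat (2 * L')" using g'(1) by (simp add: card_Diff_subset)
    ultimately have "2 * L' \<le> int (card (\<Union>\<P>))" by linarith
    moreover have "{1..L'} \<subseteq> g' ` \<Union>\<P>" unfolding bij_betw_imp_surj_on[OF g'(2)] using that(3) by auto
    moreover have "g' ` \<Union>\<P> \<subseteq> {- L'..L'}" using bij_betw_imp_surj_on[OF g'(2)] by simp
    ultimately show thesis using bij_betw_imp_inj_on[OF g'(2)] g'(1,3)
      by (intro result[of L' g'] disjI1 conjI)
  qed
  show thesis
  proof (cases "odd (card \<T>)")
    case True
    then obtain q where q: "card \<T> = 2 * q + 1" by (auto elim: oddE)
    then obtain S0 where S0: "S0 \<in> \<T>" by fastforce
    then obtain e0 where "e0 \<in> S0" by (fastforce simp: \<T>_def card_3_iff)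
    have "card S = 3" if "S \<in> \<T>" for S using that by (simp add: \<T>_def)
    from zero_sum_triples[OF q disjT this S0 \<open>e0 \<in> S0\<close>] obtain g :: "'b \<Rightarrow> int" where
      g: "bij_betw g (\<Union>\<T>) {- 3 * int q - 1..3 * int q + 1}" "\<And>S. S \<in> \<T> \<Longrightarrow> sum g S = 0"
      by blast
    have "bij_betw g (\<Union>\<T>) ({- (3 * int q + 1)..3 * int q + 1} - {})" using g(1) by simp
    then show thesis by (rule finish[OF _ _ _ g(2) TP]) (use card2 in simp_all)
  next
    case False
    then obtain q where q: "card \<T> = 2 * q" by (auto elim: evenE)
    \<comment> \<open>An extra block \<open>S0\<close> makes the number of triples odd. The summand
      \<open>nat\<close> supplies dummy elements, and the dummy \<open>Inr 0\<close> in
      \<open>S0\<close> is given offset 0.\<close>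
    have triples: "\<exists>g :: 'b + nat \<Rightarrow> int. bij_betw g (\<Union>(insert S0 ((`) Inl ` \<T>))) {- 3 * int q - 1..3 * int q + 1} \<and>
        (\<forall>S\<in>insert S0 ((`) Inl ` \<T>). sum g S = 0) \<and> g (Inr 0) = 0"
      if S0: "card S0 = 3" "Inr 0 \<in> S0" "\<forall>S\<in>\<T>. S0 \<inter> Inl ` S = {}" for S0 :: "('b + nat) set"
    proof -
      have inj: "inj_on ((`) Inl) \<T>" by (auto simp: inj_on_def inj_image_eq_iff)
      have notin: "S0 \<notin> (`) Inl ` \<T>" using S0(2) by auto
      let ?F = "insert S0 ((`) Inl ` \<T>)"
      have c: "card ?F = 2 * q + 1"
        using finT notin card_image[OF inj] q by simp
      have d: "disjoint ?F"
      proof (rule disjointI)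
        fix A B assume AB: "A \<in> ?F" "B \<in> ?F" "A \<noteq> B"
        have "Inl ` S \<inter> Inl ` S' = ({} :: ('b + nat) set)" if "S \<in> \<T>" "S' \<in> \<T>" "S \<noteq> S'" for S S'
          using disjointD[OF disjT that] by auto
        then show "A \<inter> B = {}" using AB S0(3) by (elim insertE imageE) (simp_all, blast+)
      qed
      have t: "card S = 3" if "S \<in> ?F" for S
        using that S0(1) by (auto simp: card_image \<T>_def)
      obtain g :: "'b + nat \<Rightarrow> int" where "bij_betw g (\<Union>?F) {- 3 * int q - 1..3 * int q + 1}"
        "\<And>S. S \<in> ?F \<Longrightarrow> sum g S = 0" "g (Inr 0) = 0"
        using zero_sum_triples[OF c d t insertI1 S0(2)] by blast
      then show ?thesis by blast
    qed
    show thesis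
    proof (cases "\<Q> = {}")
      case True
      then have PT: "\<P> = \<T>" using \<P> by simp
      show thesis
      proof (cases "\<T> = {}")
        case True
        then have "\<P> = {}" using PT by simp
        then show thesis by (intro that[of 0 "\<lambda>_. 0"]) auto
      next
        case False
        let ?G = "Inr ` {0, 1, 2} :: ('b + nat) set"
        have "card ?G = 3" by (subst card_image) auto
        then obtain g :: "'b + nat \<Rightarrow> int" where
          g: "bij_betw g (\<Union>(insert ?G ((`) Inl ` \<T>))) {- 3 * int q - 1..3 * int q + 1}"
            "\<And>S. S \<in> \<T> \<Longrightarrow> sum g (Inl ` S) = 0"
          using triples[of ?G] by blast
        have cU: "card (\<Union>\<P>) = 6 * q"
        proof -
          have "card (\<Union>\<T>) = sum card \<T>"
            using disjT by (intro card_Union_disjoint) (auto simp: \<T>_def card_ge_0_finite)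
          also have "\<dots> = 6 * q" using q by (simp add: \<T>_def)
          finally show ?thesis unfolding PT .
        qed
        show thesis
        proof (rule that[of "3 * int q + 1" "g \<circ> Inl"])
          have sub: "Inl ` \<Union>\<P> \<subseteq> \<Union>(insert ?G ((`) Inl ` \<T>))" using PT by auto
          show "inj_on (g \<circ> Inl) (\<Union>\<P>)"
            by (intro comp_inj_on inj_on_subset[OF bij_betw_imp_inj_on[OF g(1)] sub]) simp
          show "(g \<circ> Inl) ` \<Union>\<P> \<subseteq> {- (3 * int q + 1)..3 * int q + 1}"
            using image_mono[OF sub, of g] bij_betw_imp_surj_on[OF g(1)]
            unfolding image_comp[symmetric] by (simp only:) simp
          show "sum (g \<circ> Inl) S = 0" if "S \<in> \<P>" for S
            using g(2)[of S] that PT by (simp add: sum.reindex)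
          have "\<forall>S\<in>\<P>. card S = 3" unfolding PT by (simp add: \<T>_def)
          then show "{1..3 * int q + 1} \<subseteq> (g \<circ> Inl) ` \<Union>\<P> \<and> 2 * (3 * int q + 1) \<le> int (card (\<Union>\<P>)) \<or>
            \<P> \<noteq> {} \<and> (\<forall>S\<in>\<P>. card S = 3) \<and> 2 * (3 * int q + 1) \<le> int (card (\<Union>\<P>)) + 2"
            using cU False PT by simp
        qed simp
      qed
    next
      case False
      then obtain Q where Q: "Q \<in> \<Q>" by blast
      then have cQ: "card Q = 2" and QP: "Q \<in> \<P>" by (simp_all add: \<Q>_def)
      let ?S0 = "insert (Inr 0) (Inl ` Q) :: ('b + nat) set"
      have finQ: "finite Q" using cQ by (simp add: card_ge_0_finite)
      have c3: "card ?S0 = 3" using cQ finQ by (subst card_insert_disjoint) (auto simp: card_image)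
      have d3: "\<forall>S\<in>\<T>. ?S0 \<inter> Inl ` S = {}"
      proof
        fix S assume that: "S \<in> \<T>"
        have "Q \<noteq> S" using cQ that by (auto simp: \<T>_def)
        then have "Q \<inter> S = {}" using disjointD[OF disj QP, of S] TP that by blast
        then show "?S0 \<inter> Inl ` S = {}" by auto
      qed
      obtain g where
        g: "bij_betw g (\<Union>(insert ?S0 ((`) Inl ` \<T>))) {- 3 * int q - 1..3 * int q + 1}"
          "\<forall>S\<in>insert ?S0 ((`) Inl ` \<T>). sum g S = 0" "g (Inr 0) = 0"
        using triples[OF c3 insertI1 d3] by (elim exE conjE)
      have U: "\<Union>(insert ?S0 ((`) Inl ` \<T>)) - {Inr 0} = Inl ` \<Union>(insert Q \<T>)" by auto
      have "bij_betw g (\<Union>(insert ?S0 ((`) Inl ` \<T>)) - {Inr 0}) ({- 3 * int q - 1..3 * int q + 1} - {0})"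
        using g(1) by (rule bij_betw_DiffI) (simp_all add: g(3) bij_betw_def)
      then have "bij_betw g (Inl ` \<Union>(insert Q \<T>)) ({- (3 * int q + 1)..3 * int q + 1} - {0})"
        unfolding U by simp
      then have "bij_betw (g \<circ> Inl) (\<Union>(insert Q \<T>)) ({- (3 * int q + 1)..3 * int q + 1} - {0})"
        by (rule bij_betw_trans[rotated]) (simp add: bij_betw_def)
      note bij = this
      have zero: "sum (g \<circ> Inl) S = 0" if "S \<in> insert Q \<T>" for S
      proof (cases "S = Q")
        case True
        have "sum g ?S0 = g (Inr 0) + sum g (Inl ` Q)" using finQ by (subst sum.insert) auto
        then show ?thesis using g(2,3) True by (simp add: sum.reindex)
      next
        case False
        then have "sum g (Inl ` S) = 0" using g(2) that by blast
        then show ?thesis by (simp add: sum.reindex)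
      qed
      have sub: "insert Q \<T> \<subseteq> \<P>" using TP QP by blast
      show thesis by (rule finish[OF bij _ _ zero sub]) (use card2 in simp_all)
    qed
  qed
qed

text \<open>A pair is split off only while at least four elements are present, so a single element
  is never left over.\<close>

lemma partition_into_pairs_and_triples:
  assumes "finite S" "card S \<noteq> 1"
  shows "\<exists>\<P>. partition_on S \<P> \<and> (\<forall>p\<in>\<P>. card p = 2 \<or> card p = 3)"
  using assms
proof (induction "card S" arbitrary: S rule: less_induct)
  case less
  consider "card S = 0" | "card S = 2 \<or> card S = 3" | "card S \<ge> 4" using less.prems(2) by linarith
  then show ?case
  proof cases
    case 1
    then show ?thesis using less.prems by (intro exI[of _ "{}"]) (auto simp: partition_on_def)
  next
    case 2
    then show ?thesis by (intro exI[of _ "{S}"]) (auto simp: partition_on_def)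
  next
    case 3
    then obtain T where T: "T \<subseteq> S" "card T = 2"
      using obtain_subset_with_card_n[of 2 S] by auto
    have "card (S - T) = card S - 2" using T less.prems(1) finite_subset by (subst card_Diff_subset) auto
    then obtain \<P> where \<P>: "partition_on (S - T) \<P>" "\<forall>p\<in>\<P>. card p = 2 \<or> card p = 3"
      using less.hyps[of "S - T"] less.prems(1) 3 by fastforce
    have "T \<inter> p = {}" if "p \<in> \<P>" for p using \<P>(1) that unfolding partition_on_def by blast
    moreover have "T \<noteq> {}" using T(2) by auto
    moreover have "\<Union>(insert T \<P>) = S" using T(1) \<P>(1) unfolding partition_on_def by auto
    ultimately have "partition_on S (insert T \<P>)"
      using \<P>(1) unfolding partition_on_def disjoint_def by blast
    then show ?thesis using T(2) \<P>(2) by (intro exI[of _ "insert T \<P>"]) simp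
  qed
qed

text \<open>Labels of the form \<open>\<mu> + g e\<close> with zero-sum offsets give
  \<open>H i\<close> the sum \<open>\<mu> * card (H i)\<close>. A coincidence would make the
  difference of two free labels a nonzero multiple of \<open>\<mu>\<close>. The labels up to
  \<open>k\<close> are reserved for other arcs, and \<open>n\<close> labels stay free.\<close>

lemma labels_with_proportional_block_sums:
  fixes H :: "'i \<Rightarrow> 'e set" and k n N :: nat
  assumes fin: "finite I" "\<And>i. i \<in> I \<Longrightarrow> finite (H i)" and disj: "disjoint_family_on H I"
    and card: "\<And>i. i \<in> I \<Longrightarrow> card (H i) \<noteq> 1" and N: "N = card (\<Union>i\<in>I. H i)"
    and n: "n \<ge> 1" "\<And>i. i \<in> I \<Longrightarrow> card (H i) \<ge> 3 \<Longrightarrow> n \<ge> 3"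
  obtains \<sigma> :: "'e \<Rightarrow> int" where "inj_on \<sigma> (\<Union>i\<in>I. H i)" "\<sigma> ` (\<Union>i\<in>I. H i) \<subseteq> {int k + 1..int (k + n + N)}"
    "\<And>a b i j. a \<in> {int k + 1..int (k + n + N)} - \<sigma> ` (\<Union>i\<in>I. H i) \<Longrightarrow>
      b \<in> {int k + 1..int (k + n + N)} - \<sigma> ` (\<Union>i\<in>I. H i) \<Longrightarrow> a \<noteq> b \<Longrightarrow> i \<in> I \<Longrightarrow> j \<in> I \<Longrightarrow>
      a + sum \<sigma> (H i) \<noteq> b + sum \<sigma> (H j)"
proof -
  have "\<exists>P. partition_on (H i) P \<and> (\<forall>p\<in>P. card p = 2 \<or> card p = 3)" if "i \<in> I" for i
    using partition_into_pairs_and_triples fin(2) card that by blast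
  then obtain P where P: "\<And>i. i \<in> I \<Longrightarrow> partition_on (H i) (P i)"
    and cP: "\<And>i p. i \<in> I \<Longrightarrow> p \<in> P i \<Longrightarrow> card p = 2 \<or> card p = 3" by metis
  define \<P> where "\<P> = (\<Union>i\<in>I. P i)"
  let ?U = "\<Union>i\<in>I. H i"
  have UP: "\<Union>(P i) = H i" if "i \<in> I" for i using P[OF that] by (simp add: partition_on_def)
  have "\<Union>\<P> = (\<Union>i\<in>I. \<Union>(P i))" by (auto simp: \<P>_def)
  then have U: "\<Union>\<P> = ?U" using UP by simp
  have "finite (P i)" if "i \<in> I" for i using P fin(2) that finite_elements by blast
  then have finP: "finite \<P>" using fin(1) by (auto simp: \<P>_def)
  have disjP: "disjoint \<P>"
  proof (rule disjointI)
    fix p p' assume "p \<in> \<P>" "p' \<in> \<P>" and ne: "p \<noteq> p'"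
    then obtain i j where i: "i \<in> I" "p \<in> P i" and j: "j \<in> I" "p' \<in> P j" by (auto simp: \<P>_def)
    show "p \<inter> p' = {}"
    proof (cases "i = j")
      case True
      then show ?thesis using disjointD[OF partition_onD2[OF P[OF i(1)]], of p p'] i j ne by blast
    next
      case False
      then have "H i \<inter> H j = {}" using disj i j by (auto simp: disjoint_family_on_def)
      then show ?thesis using UP[OF i(1)] UP[OF j(1)] i j by blast
    qed
  qed
  have cp: "card S = 2 \<or> card S = 3" if "S \<in> \<P>" for S using cP that by (auto simp: \<P>_def)
  obtain g :: "'e \<Rightarrow> int" and L where L: "L \<ge> 0" and inj: "inj_on g ?U" and img: "g ` ?U \<subseteq> {- L..L}"
    and zero: "\<And>S. S \<in> \<P> \<Longrightarrow> sum g S = 0"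
    and alt: "{1..L} \<subseteq> g ` ?U \<and> 2 * L \<le> int N \<or>
     \<P> \<noteq> {} \<and> (\<forall>S\<in>\<P>. card S = 3) \<and> 2 * L \<le> int N + 2"
    using zero_sum_offsets[OF finP disjP cp, unfolded U N[symmetric]] by metis
  define m where "m = int (k + n + N)"
  \<comment> \<open>The largest possible offset \<open>L\<close> is thereby placed at the top label
    \<open>m\<close>.\<close>
  define \<mu> where "\<mu> = m - L"
  define \<sigma> where "\<sigma> e = \<mu> + g e" for e
  have fin_piece: "finite p" if "p \<in> P i" "i \<in> I" for p i
    using cP[OF that(2,1)] by (auto intro: card_ge_0_finite)
  have sumH: "sum \<sigma> (H i) = \<mu> * int (card (H i))" if i: "i \<in> I" for i
  proof -
    have "sum g (\<Union>(P i)) = (sum \<circ> sum) g (P i)"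
    proof (rule sum.Union_disjoint)
      show "\<forall>A\<in>P i. \<forall>B\<in>P i. A \<noteq> B \<longrightarrow> A \<inter> B = {}"
        using disjointD[OF partition_onD2[OF P[OF i]]] by simp
    qed (use fin_piece i in blast)
    also have "(sum \<circ> sum) g (P i) = 0" unfolding comp_def
      by (rule sum.neutral) (use zero i in \<open>auto simp: \<P>_def\<close>)
    finally show ?thesis using UP[OF i] by (simp add: \<sigma>_def sum.distrib)
  qed
  have n3: "n \<ge> 3" if triple: "\<P> \<noteq> {}" "\<forall>S\<in>\<P>. card S = 3"
  proof -
    obtain i p where i: "i \<in> I" "p \<in> P i" using triple(1) by (auto simp: \<P>_def)
    then have "card p = 3" using triple(2) by (auto simp: \<P>_def)
    moreover have "card p \<le> card (H i)" using i UP fin(2) by (intro card_mono) auto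
    ultimately show ?thesis using n(2)[OF i(1)] by simp
  qed
  \<comment> \<open>The smallest label used may be as low as \<open>m - 2 * L\<close>, which has to
    exceed \<open>k\<close>. The triple of gaps costs two more labels; \<open>n \<ge> 3\<close> pays
    for them.\<close>
  have mL: "m - 2 * L \<ge> int k + 1"
    using alt
  proof (elim disjE conjE)
    assume "2 * L \<le> int N"
    then show ?thesis using n(1) by (simp add: m_def)
  next
    assume "\<P> \<noteq> {}" "\<forall>S\<in>\<P>. card S = 3" "2 * L \<le> int N + 2"
    then show ?thesis using n3 by (simp add: m_def)
  qed
  have sub: "\<sigma> ` ?U \<subseteq> {int k + 1..m}"
  proof (rule image_subsetI)
    fix e assume "e \<in> ?U"
    then have "g e \<in> {- L..L}" using img by blast
    then show "\<sigma> e \<in> {int k + 1..m}" using mL by (auto simp: \<sigma>_def \<mu>_def)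
  qed
  have key: "a + sum \<sigma> (H i) \<noteq> b + sum \<sigma> (H j)"
    if a: "a \<in> {int k + 1..m} - \<sigma> ` ?U" and b: "b \<in> {int k + 1..m} - \<sigma> ` ?U"
      and ne: "a \<noteq> b" and i: "i \<in> I" and j: "j \<in> I" for a b i j
  proof
    assume eq: "a + sum \<sigma> (H i) = b + sum \<sigma> (H j)"
    have ab: "a - b = \<mu> * (int (card (H j)) - int (card (H i)))"
      using eq sumH i j by (simp add: algebra_simps)
    show False
      using alt
    proof (elim disjE conjE)
      assume pos: "{1..L} \<subseteq> g ` ?U"
      \<comment> \<open>All labels above \<open>\<mu>\<close> are in use, so free labels are
        positive and at most \<open>\<mu>\<close>, hence less than \<open>\<mu>\<close>
        apart.\<close>
      have le: "c \<le> \<mu>" if c: "c \<in> {int k + 1..m} - \<sigma> ` ?U" for c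
      proof (rule ccontr)
        assume "\<not> c \<le> \<mu>"
        then have "c - \<mu> \<in> {1..L}" using c by (auto simp: \<mu>_def)
        then obtain e where "e \<in> ?U" "c - \<mu> = g e" using pos by blast
        then have "c \<in> \<sigma> ` ?U" by (force simp: \<sigma>_def)
        then show False using c by blast
      qed
      have "\<bar>a - b\<bar> < \<mu>" using le[OF a] le[OF b] a b by auto
      moreover have "\<mu> dvd a - b" using ab by simp
      ultimately show False using ne dvd_imp_le_int[of "a - b"] by fastforce
    next
      assume triple: "\<P> \<noteq> {}" "\<forall>S\<in>\<P>. card S = 3" "2 * L \<le> int N + 2"
      \<comment> \<open>Here free labels may exceed \<open>\<mu>\<close>, but all block sizes are
        divisible by 3, so the difference would be a multiple of \<open>3 * \<mu>\<close>. This is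
        too large because \<open>m > 2 * L\<close>.\<close>
      have three: "3 dvd int (card (H i))" if i: "i \<in> I" for i
      proof -
        have "card (\<Union>(P i)) = sum card (P i)"
          using partition_onD2[OF P[OF i]] fin_piece i by (intro card_Union_disjoint) blast+
        also have "\<dots> = 3 * card (P i)" using triple(2) i by (auto simp: \<P>_def)
        finally show ?thesis using UP[OF i] by simp
      qed
      have "3 dvd int (card (H j)) - int (card (H i))" by (intro dvd_diff three i j)
      then have "\<mu> * 3 dvd a - b" unfolding ab by (rule mult_dvd_mono[OF dvd_refl])
      moreover have "\<bar>a - b\<bar> < \<mu> * 3" using a b mL L by (auto simp: \<mu>_def)
      ultimately show False using ne dvd_imp_le_int[of "a - b"] by fastforce
    qed
  qed
  have "inj_on \<sigma> ?U" using inj by (auto simp: \<sigma>_def inj_on_def)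
  then show thesis using sub key unfolding m_def by (rule that)
qed

subsection \<open>Antimagic orientations\<close>

text \<open>The arcs fall into three classes: \<open>D0\<close> inside \<open>C\<close>, labelled up
  to \<open>k\<close>; the arcs \<open>(i, f i)\<close>, forming \<open>F\<close>, with labels in
  \<open>\<Lambda>\<close>; and the other arcs out of \<open>I\<close>, forming \<open>U\<close>,
  with prescribed block sums.\<close>

lemma ex_antimagic_orientation_of_bipartite:
  fixes V :: "'a set"
  assumes finV: "finite V" and E: "E \<subseteq> V \<times> V" "sym E" "irrefl E"
    and XY: "V = X \<union> Y" "X \<inter> Y = {}" "E \<subseteq> X \<times> Y \<union> Y \<times> X"
    and deg: "\<And>v. v \<in> V \<Longrightarrow> card {w. (v, w) \<in> E} \<noteq> 0 \<and> card {w. (v, w) \<in> E} \<noteq> 2"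
  shows "\<exists>D \<sigma>. orients D E \<and> bij_betw \<sigma> D {1..int (card D)} \<and> inj_on (net_sum D \<sigma>) V"
proof (cases "V = {}")
  case True
  then have "E = {}" using E by blast
  then have "orients {} E \<and> bij_betw (\<lambda>_. 0) {} {1..int (card ({} :: ('a \<times> 'a) set))}"
    by (simp add: orients_def bij_betw_def)
  then show ?thesis using True by blast
next
  case False
  have finE: "finite E" using E(1) finV by (meson finite_SigmaI finite_subset)
  have "\<exists>w. (v, w) \<in> E" if "v \<in> V" for v
    using deg[OF that] by (metis Collect_empty_eq card.empty)
  then obtain I f where IV: "I \<subseteq> V" and ind: "\<And>i j. i \<in> I \<Longrightarrow> j \<in> I \<Longrightarrow> (i, j) \<notin> E"
    and fE: "\<And>i. i \<in> I \<Longrightarrow> (i, f i) \<in> E" and fI: "f ` I = V - I"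
    using ex_independent_set_onto_complement[OF finV E(1,2) XY] by metis
  define C where "C = V - I"
  have finI: "finite I" and finC: "finite C" using IV finV finite_subset by (auto simp: C_def)
  have IE: "c \<in> C" if "i \<in> I" "(i, c) \<in> E" for i c using that ind E(1) by (auto simp: C_def)
  have card_IC: "card C \<le> card I" using fI card_image_le[OF finI, of f] by (simp add: C_def)
  have I_ne: "I \<noteq> {}" using False fI by auto
  define K where "K = E \<inter> C \<times> C"
  have "finite K" "sym K" "irrefl K"
    using finE E(2,3) by (auto simp: K_def sym_def irrefl_def)
  then obtain D0 and \<sigma>0 :: "'a \<times> 'a \<Rightarrow> int" where D0: "orients D0 K"
    and \<sigma>0: "bij_betw \<sigma>0 D0 {1..int (card D0)}" and net0: "\<And>v. net_sum D0 \<sigma>0 v \<ge> - int (card D0)"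
    using ex_orients_net_sum_ge by metis
  define k where "k = card D0"
  define n where "n = card I"
  define H where "H i = (\<lambda>c. (i, c)) ` ({c. (i, c) \<in> E} - {f i})" for i
  define U where "U = (\<Union>i\<in>I. H i)"
  define N where "N = card U"
  define F where "F = (\<lambda>i. (i, f i)) ` I"
  have finN: "finite {c. (i, c) \<in> E}" for i
    using finV by (rule rev_finite_subset) (use E(1) in auto)
  have finH: "finite (H i)" for i unfolding H_def using finN by simp
  have cardH: "card (H i) = card {c. (i, c) \<in> E} - 1" if "i \<in> I" for i
    unfolding H_def using fE[OF that] finN by (subst card_image) (auto simp: inj_on_def)
  have U_iff: "(u, v) \<in> U \<longleftrightarrow> u \<in> I \<and> (u, v) \<in> E \<and> v \<noteq> f u" for u v
    by (auto simp: U_def H_def)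
  have F_iff: "(u, v) \<in> F \<longleftrightarrow> u \<in> I \<and> v = f u" for u v by (auto simp: F_def)
  have finU: "finite U" using finI finH by (simp add: U_def)
  have finF: "finite F" using finI by (simp add: F_def)
  have D0K: "D0 \<subseteq> E" "D0 \<subseteq> C \<times> C" using D0 by (auto simp: orients_def K_def)
  have finD0: "finite D0" using D0K(1) finE finite_subset by blast
  have dis: "D0 \<inter> U = {}" "(D0 \<union> U) \<inter> F = {}"
    using D0K(2) by (auto simp: U_iff F_iff C_def)
  have "disjoint_family_on H I" by (auto simp: disjoint_family_on_def H_def)
  \<comment> \<open>This is where degree 2 is excluded: a single arc besides \<open>(i, f i)\<close>
    could not be split into pairs and triples.\<close>
  moreover have "card (H i) \<noteq> 1" if "i \<in> I" for i 
    using cardH[OF that] deg[OF subsetD[OF IV that]] by arith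
  moreover have "n \<ge> 1" using I_ne finI by (simp add: n_def Suc_le_eq card_gt_0_iff)
  \<comment> \<open>All neighbours of \<open>i\<close> lie in \<open>C\<close>, and \<open>I\<close>
    is at least as large as \<open>C\<close> because \<open>f\<close> maps onto
    \<open>C\<close>.\<close>
  moreover have "n \<ge> 3" if "i \<in> I" "card (H i) \<ge> 3" for i
  proof -
    have "card {c. (i, c) \<in> E} \<le> card C" using IE[OF that(1)] finC by (intro card_mono) auto
    then show ?thesis using that cardH[OF that(1)] card_IC by (simp add: n_def)
  qed
  ultimately obtain \<sigma>1 :: "'a \<times> 'a \<Rightarrow> int" where inj1: "inj_on \<sigma>1 U"
    and img1: "\<sigma>1 ` U \<subseteq> {int k + 1..int (k + n + N)}"
    and free: "\<And>a b i j. a \<in> {int k + 1..int (k + n + N)} - \<sigma>1 ` U \<Longrightarrow>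
      b \<in> {int k + 1..int (k + n + N)} - \<sigma>1 ` U \<Longrightarrow> a \<noteq> b \<Longrightarrow> i \<in> I \<Longrightarrow> j \<in> I \<Longrightarrow>
      a + sum \<sigma>1 (H i) \<noteq> b + sum \<sigma>1 (H j)"
    using labels_with_proportional_block_sums[of I H N n k, folded U_def] finI finH N_def by metis
  define \<Lambda> where "\<Lambda> = {int k + 1..int (k + n + N)} - \<sigma>1 ` U"
  have "card \<Lambda> = card I"
    unfolding \<Lambda>_def using img1 finU inj1 by (subst card_Diff_subset) (auto simp: card_image N_def n_def)
  \<comment> \<open>The part of the sum at \<open>c\<close> that is fixed before the labels in
    \<open>\<Lambda>\<close> are distributed. Any distribution separates the sums on
    \<open>I\<close>, so it may be chosen for the sake of \<open>C\<close> alone.\<close>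
  moreover define base where "base c = net_sum D0 \<sigma>0 c + (\<Sum>a | a \<in> U \<and> snd a = c. \<sigma>1 a)" for c
  ultimately obtain \<phi> where \<phi>: "bij_betw \<phi> I \<Lambda>"
    and inj_center: "inj_on (\<lambda>c. base c + (\<Sum>i | i \<in> I \<and> f i = c. \<phi> i)) C"
    using ex_bij_inj_on_fiber_sums[of I \<Lambda> f C base] finI fI by (auto simp: C_def \<Lambda>_def)
  have \<phi>_ge: "\<phi> i \<ge> int k + 1" if "i \<in> I" for i
    using bij_betwE[OF \<phi>] that by (auto simp: \<Lambda>_def)
  have \<sigma>1_ge: "\<sigma>1 a \<ge> int k + 1" if "a \<in> U" for a using img1 that by auto
  define D where "D = D0 \<union> U \<union> F"
  define \<sigma> where "\<sigma> a = (if a \<in> D0 then \<sigma>0 a else if a \<in> U then \<sigma>1 a else \<phi> (fst a))" for a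
  have \<sigma>D0: "\<sigma> a = \<sigma>0 a" if "a \<in> D0" for a using that by (simp add: \<sigma>_def)
  have \<sigma>U: "\<sigma> a = \<sigma>1 a" if "a \<in> U" for a using that dis by (auto simp: \<sigma>_def)
  have \<sigma>F: "\<sigma> (i, f i) = \<phi> i" if "i \<in> I" for i
    using that dis F_iff[of i "f i"] by (auto simp: \<sigma>_def)
  have "orients D E"
  proof -
    have mem: "(u, v) \<in> D \<longleftrightarrow> (u, v) \<in> D0 \<or> u \<in> I \<and> (u, v) \<in> E" for u v
      using fE by (auto simp: D_def U_iff F_iff)
    have "(u, v) \<in> D \<longleftrightarrow> (v, u) \<notin> D" if uv: "(u, v) \<in> E" for u v
    proof -
      have vu: "(v, u) \<in> E" using symD[OF E(2) uv] .
      show ?thesis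
      proof (cases "u \<in> I \<or> v \<in> I")
        case True
        then have "(u, v) \<notin> D0" "(v, u) \<notin> D0" using D0K(2) by (auto simp: C_def)
        then show ?thesis using mem True uv vu ind by blast
      next
        case False
        then have "(u, v) \<in> K" using uv E(1) by (auto simp: K_def C_def)
        then have "(u, v) \<in> D0 \<longleftrightarrow> (v, u) \<notin> D0" using D0 by (auto simp: orients_def)
        then show ?thesis using mem False by blast
      qed
    qed
    moreover have "D \<subseteq> E" using mem D0K(1) by auto
    ultimately show ?thesis by (auto simp: orients_def)
  qed
  moreover have "bij_betw \<sigma> D {1..int (card D)}"
  proof -
    have "bij_betw \<sigma> D0 {1..int k}" using \<sigma>0 bij_betw_cong[of D0 \<sigma> \<sigma>0] \<sigma>D0 by (simp add: k_def)
    moreover have "bij_betw \<sigma> U (\<sigma>1 ` U)"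
      using inj_on_imp_bij_betw[OF inj1] bij_betw_cong[of U \<sigma> \<sigma>1] \<sigma>U by simp
    ultimately have "bij_betw \<sigma> (D0 \<union> U) ({1..int k} \<union> \<sigma>1 ` U)"
      by (rule bij_betw_combine) (use img1 in auto)
    moreover have "bij_betw \<sigma> F \<Lambda>"
    proof -
      have "bij_betw fst F I" by (auto simp: bij_betw_def F_def inj_on_def image_image)
      then have "bij_betw (\<phi> \<circ> fst) F \<Lambda>" using \<phi> by (rule bij_betw_trans)
      moreover have "\<sigma> a = (\<phi> \<circ> fst) a" if "a \<in> F" for a using that \<sigma>F by (auto simp: F_def)
      ultimately show ?thesis using bij_betw_cong[of F \<sigma> "\<phi> \<circ> fst"] by simp
    qed
    ultimately have "bij_betw \<sigma> D ({1..int k} \<union> \<sigma>1 ` U \<union> \<Lambda>)"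
      unfolding D_def by (rule bij_betw_combine) (auto simp: \<Lambda>_def)
    moreover have "{1..int k} \<union> \<sigma>1 ` U \<union> \<Lambda> = {1..int (k + n + N)}"
      using img1 unfolding \<Lambda>_def by auto
    moreover have "card D = k + n + N"
    proof -
      have "card F = n" unfolding F_def n_def by (rule card_image) (simp add: inj_on_def)
      then show ?thesis unfolding D_def using dis finD0 finU finF
        by (simp add: card_Un_disjoint k_def N_def)
    qed
    ultimately show ?thesis by simp
  qed
  moreover have "inj_on (net_sum D \<sigma>) V"
  proof -
    have center: "net_sum D \<sigma> c = base c + (\<Sum>i | i \<in> I \<and> f i = c. \<phi> i)" if c: "c \<in> C" for c
    proof -
      have "{a \<in> D. snd a = c} = {a \<in> D0. snd a = c} \<union> {a \<in> U. snd a = c} \<union> {a \<in> F. snd a = c}"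
        by (auto simp: D_def)
      then have "(\<Sum>a | a \<in> D \<and> snd a = c. \<sigma> a) = (\<Sum>a | a \<in> D0 \<and> snd a = c. \<sigma> a) +
          (\<Sum>a | a \<in> U \<and> snd a = c. \<sigma> a) + (\<Sum>a | a \<in> F \<and> snd a = c. \<sigma> a)"
        using dis finD0 finU finF by (simp only:) (subst sum.union_disjoint, auto)+
      moreover have "(\<Sum>a | a \<in> D0 \<and> snd a = c. \<sigma> a) = (\<Sum>a | a \<in> D0 \<and> snd a = c. \<sigma>0 a)"
        by (intro sum.cong) (simp_all add: \<sigma>D0)
      moreover have "(\<Sum>a | a \<in> U \<and> snd a = c. \<sigma> a) = (\<Sum>a | a \<in> U \<and> snd a = c. \<sigma>1 a)"
        by (intro sum.cong) (simp_all add: \<sigma>U)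
      moreover have "(\<Sum>a | a \<in> F \<and> snd a = c. \<sigma> a) = (\<Sum>i | i \<in> I \<and> f i = c. \<phi> i)"
      proof -
        have "{a \<in> F. snd a = c} = (\<lambda>i. (i, f i)) ` {i \<in> I. f i = c}" by (auto simp: F_def)
        then have "(\<Sum>a | a \<in> F \<and> snd a = c. \<sigma> a) = (\<Sum>i | i \<in> I \<and> f i = c. \<sigma> (i, f i))"
          by (simp only:) (subst sum.reindex, simp_all add: inj_on_def)
        also have "\<dots> = (\<Sum>i | i \<in> I \<and> f i = c. \<phi> i)" using \<sigma>F by (intro sum.cong) auto
        finally show ?thesis .
      qed
      moreover have "(\<Sum>a | a \<in> D \<and> fst a = c. \<sigma> a) = (\<Sum>a | a \<in> D0 \<and> fst a = c. \<sigma>0 a)"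
        using c by (intro sum.cong) (auto simp: D_def U_iff F_iff C_def \<sigma>D0)
      ultimately show ?thesis by (simp add: base_def net_sum_def)
    qed
    \<comment> \<open>Every arc of \<open>D\<close> ends in \<open>C\<close>, so only outgoing
      labels count at \<open>i\<close>.\<close>
    have leaf: "net_sum D \<sigma> i = - (\<phi> i + sum \<sigma>1 (H i))" if i: "i \<in> I" for i
    proof -
      have "v \<in> C" if "(u, v) \<in> D" for u v
        using that D0K(2) IE fE by (auto simp: D_def U_iff F_iff)
      then have "{a \<in> D. snd a = i} = {}" using i by (fastforce simp: C_def)
      then have "(\<Sum>a | a \<in> D \<and> snd a = i. \<sigma> a) = 0" by (simp only: sum.empty)
      moreover have "{a \<in> D. fst a = i} = insert (i, f i) (H i)"
        using i D0K(2) by (auto simp: D_def U_iff F_iff C_def H_def)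
      moreover have "sum \<sigma> (insert (i, f i) (H i)) = \<phi> i + sum \<sigma> (H i)"
        using finH \<sigma>F[OF i] by (subst sum.insert) (auto simp: H_def)
      moreover have "sum \<sigma> (H i) = sum \<sigma>1 (H i)"
        using i by (intro sum.cong) (auto simp: U_def intro!: \<sigma>U)
      ultimately show ?thesis by (simp only: net_sum_def)
    qed
    \<comment> \<open>The loss of \<open>c\<close> inside \<open>C\<close> is at most
      \<open>k\<close>, while some arc \<open>(i, f i)\<close> brings it a label of at least
      \<open>k + 1\<close>.\<close>
    have pos: "net_sum D \<sigma> c > 0" if c: "c \<in> C" for c
    proof -
      obtain i where i: "i \<in> I" "f i = c"
        using c unfolding C_def fI[symmetric] by blast
      have "\<phi> i \<le> (\<Sum>i | i \<in> I \<and> f i = c. \<phi> i)"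
        using i finI \<phi>_ge by (intro member_le_sum) force+
      moreover have "(\<Sum>a | a \<in> U \<and> snd a = c. \<sigma>1 a) \<ge> 0" using \<sigma>1_ge by (intro sum_nonneg) force
      ultimately show ?thesis
        using center[OF c] net0[of c] \<phi>_ge[OF i(1)] by (simp add: base_def k_def)
    qed
    have neg: "net_sum D \<sigma> i < 0" if i: "i \<in> I" for i
    proof -
      have "sum \<sigma>1 (H i) \<ge> 0" using \<sigma>1_ge i by (intro sum_nonneg) (force simp: U_def)
      then show ?thesis using leaf[OF i] \<phi>_ge[OF i] by simp
    qed
    have "inj_on (net_sum D \<sigma>) C" using inj_center center by (simp cong: inj_on_cong)
    moreover have "inj_on (net_sum D \<sigma>) I"
    proof (rule inj_onI, rule ccontr)
      fix i j assume ij: "i \<in> I" "j \<in> I" "net_sum D \<sigma> i = net_sum D \<sigma> j" "i \<noteq> j"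
      have "\<phi> i \<noteq> \<phi> j" using \<phi> ij by (auto simp: bij_betw_def inj_on_def)
      moreover have "\<phi> i \<in> \<Lambda>" "\<phi> j \<in> \<Lambda>" using bij_betwE[OF \<phi>] ij by auto
      ultimately have "\<phi> i + sum \<sigma>1 (H i) \<noteq> \<phi> j + sum \<sigma>1 (H j)"
        using ij unfolding \<Lambda>_def by (intro free)
      then show False using ij leaf by simp
    qed
    moreover have "net_sum D \<sigma> ` C \<inter> net_sum D \<sigma> ` I = {}" using pos neg by force
    moreover have "V = C \<union> I" using IV by (auto simp: C_def)
    moreover have "C - I = C" "I - C = I" by (auto simp: C_def)
    ultimately show ?thesis by (simp add: inj_on_Un)
  qed
  ultimately show ?thesis by blast
qed

text \<open>The result on bare relations carries over: neighbours of \<open>v\<close> correspond to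
  arcs leaving \<open>v\<close>, and \<open>net_sum\<close> agrees with
  \<open>oriented_vertex_sum\<close> on the digraph with arc set \<open>D\<close>.\<close>

theorem theorem3:
  fixes G :: "'a pair_pre_digraph"
  assumes "pair_graph G"
    and "bipartite (with_proj G)"
    and "\<And>v. v \<in> pverts G \<Longrightarrow> out_degree (with_proj G) v \<noteq> 0 \<and> out_degree (with_proj G) v \<noteq> 2"
  shows "admits_antimagic_orientation G"
proof -
  interpret pair_graph G by fact
  let ?E = "parcs G"
  have E: "?E \<subseteq> pverts G \<times> pverts G" using in_arcsD1 in_arcsD2 by auto
  have "sym ?E" by (rule pair_sym_arcs[unfolded symmetric_def arcs_ends_conv, simplified])
  moreover have "irrefl ?E" using pair_no_loops by (fastforce simp: irrefl_def)
  moreover obtain X Y where "pverts G = X \<union> Y" "X \<inter> Y = {}" "?E \<subseteq> X \<times> Y \<union> Y \<times> X"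
    using assms(2) by (auto simp: bipartite_def arcs_ends_conv)
  moreover have "card {w. (v, w) \<in> ?E} = out_degree (with_proj G) v" for v
  proof -
    have "{e \<in> ?E. fst e = v} = Pair v ` {w. (v, w) \<in> ?E}" by auto
    then show ?thesis by (simp add: out_degree_def out_arcs_def card_image inj_on_def)
  qed
  ultimately obtain D and \<sigma> :: "'a \<times> 'a \<Rightarrow> int" where D: "orients D ?E"
    and \<sigma>: "bij_betw \<sigma> D {1..int (card D)}" "inj_on (net_sum D \<sigma>) (pverts G)"
    using ex_antimagic_orientation_of_bipartite[of "pverts G" ?E X Y] E assms(3) pair_finite_verts
    by auto
  let ?D = "\<lparr>pverts = pverts G, parcs = D\<rparr>"
  have "oriented_vertex_sum (with_proj ?D) \<sigma> = net_sum D \<sigma>"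
    by (simp add: fun_eq_iff oriented_vertex_sum_def net_sum_def in_arcs_def out_arcs_def)
  then have "antimagic_labeling (with_proj ?D) \<sigma>" using \<sigma> by (simp add: antimagic_labeling_def)
  moreover have "orientation_of G ?D" using D by (simp add: orientation_of_def orients_def)
  ultimately show ?thesis unfolding admits_antimagic_orientation_def by blast
qed

end
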